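(* For every integer $n\ge 1$, the odd graph $O_n$ satisfies the Total Coloring Conjecture; that is, $\chi''(O_n)\in\{\Delta(O_n)+1,\Delta(O_n)+2\}$.
   Context: The odd graph $O_n$ is the simple graph whose vertices are the $(n-1)$-element subsets of a fixed $(2n-1)$-element set, two distinct vertices being adjacent if and only if the corresponding subsets are disjoint. $\Delta(G)$ denotes the maximum degree of a graph $G$. A total coloring of a simple graph $G$ is an assignment of colors to the vertices and edges of $G$ such that no two adjacent or incident elements receive the same color (adjacent vertices get different colors, distinct edges sharing an endpoint get different colors, and each edge gets a color different from those of its two endpoints). The total chromatic number $\chi''(G)$ is the least number of colors in a total coloring of $G$. *)

theory Defs
  imports Main
begin

text \<open>A simple graph is a pair of a vertex set and an edge set whose members are
  two-element sets of vertices.\<close>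

type_synonym 'v graph = "'v set \<times> 'v set set"

abbreviation verts :: "'v graph \<Rightarrow> 'v set" where
  "verts G \<equiv> fst G"

abbreviation edges :: "'v graph \<Rightarrow> 'v set set" where
  "edges G \<equiv> snd G"

definition simple_graph :: "'v graph \<Rightarrow> bool" where
  "simple_graph G \<longleftrightarrow> (\<forall>e\<in>edges G. e \<subseteq> verts G \<and> card e = 2)"

definition degree :: "'v graph \<Rightarrow> 'v \<Rightarrow> nat" where
  "degree G v = card {e \<in> edges G. v \<in> e}"

text \<open>Meaningful for finite graphs with at least one vertex.\<close>

definition max_degree :: "'v graph \<Rightarrow> nat" where
  "max_degree G = Max (degree G ` verts G)"

text \<open>The elements to be colored form the disjoint sum of the vertices and the edges.\<close>

definition total_coloring :: "'v graph \<Rightarrow> ('v + 'v set \<Rightarrow> 'c) \<Rightarrow> bool" where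
  "total_coloring G c \<longleftrightarrow>
     (\<forall>u\<in>verts G. \<forall>v\<in>verts G. {u, v} \<in> edges G \<longrightarrow> c (Inl u) \<noteq> c (Inl v)) \<and>
     (\<forall>e\<in>edges G. \<forall>f\<in>edges G. e \<noteq> f \<and> e \<inter> f \<noteq> {} \<longrightarrow> c (Inr e) \<noteq> c (Inr f)) \<and>
     (\<forall>e\<in>edges G. \<forall>v\<in>e. c (Inr e) \<noteq> c (Inl v))"

text \<open>Every finite simple graph has a total coloring with finitely many colors, so that
  for such graphs the minimum is attained.\<close>

definition total_chromatic_number :: "'v graph \<Rightarrow> nat" where
  "total_chromatic_number G =
     (LEAST k. \<exists>c :: 'v + 'v set \<Rightarrow> nat. total_coloring G c \<and> c ` (verts G <+> edges G) \<subseteq> {..<k})"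

text \<open>The odd graph on the ground set \<open>S\<close>, which is meant to have \<open>2 * n - 1\<close> elements. For
  \<open>n = 1\<close> the only vertex is the empty set; it is disjoint from itself, and the condition
  \<open>A \<noteq> B\<close> excludes the resulting loop.\<close>

definition odd_graph :: "nat \<Rightarrow> 'a set \<Rightarrow> 'a set graph" where
  "odd_graph n S =
     (let V = {A. A \<subseteq> S \<and> card A = n - 1}
      in (V, {{A, B} | A B. A \<in> V \<and> B \<in> V \<and> A \<noteq> B \<and> A \<inter> B = {}}))"

lemma simple_graph_odd_graph: "simple_graph (odd_graph n S)"
  by (auto simp: simple_graph_def odd_graph_def Let_def card_2_iff)

end

theory Submission
  imports Defs "HOL-Number_Theory.Cong"
begin

text \<open>
  Fix \<open>a \<in> S\<close>. The vertices containing \<open>a\<close> are independent, and the remaining ones induce a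
  perfect matching, since a vertex \<open>A\<close> avoiding \<open>a\<close> has the single neighbour \<open>S - A - {a}\<close> avoiding
  \<open>a\<close>. The other edges form a bipartite graph, which is properly colored with \<open>n\<close> colors by the
  modular matchings of the middle two levels of the cube of dimension \<open>2n - 1\<close>: with \<open>S\<close>
  enumerated by \<open>f\<close>, the edge from \<open>A\<close> to \<open>S - A - {x}\<close> gets the sum of \<open>f\<close> over \<open>A\<close> plus the
  rank of \<open>x\<close> in \<open>S - A\<close>, modulo \<open>n\<close>. A vertex avoiding \<open>a\<close> has only \<open>n - 1\<close> such edges and so
  misses a color, namely the one that its matching edge would get. One further color serves both
  the matching and the vertices containing \<open>a\<close>; in each matched pair one end gets its missing
  color and the other end the last of the \<open>n + 2\<close> colors.
\<close>

section \<open>Lower bound by the maximum degree\<close>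

lemma total_coloring_degree_less:
  fixes c :: "'v + 'v set \<Rightarrow> nat"
  assumes "finite (verts G)" "simple_graph G" "v \<in> verts G"
    and c: "total_coloring G c" "c ` (verts G <+> edges G) \<subseteq> {..<k}"
  shows "degree G v < k"
proof -
  let ?E = "{e \<in> edges G. v \<in> e}"
  have "edges G \<subseteq> Pow (verts G)"
    using assms(2) by (auto simp: simple_graph_def)
  then have "finite (edges G)"
    using assms(1) by (simp add: finite_subset)
  then have fin: "finite ?E"
    by simp
  have "inj_on (c \<circ> Inr) ?E"
    using c(1) unfolding total_coloring_def inj_on_def comp_def by blast
  moreover have "c (Inl v) \<notin> (c \<circ> Inr) ` ?E"
  proof
    assume "c (Inl v) \<in> (c \<circ> Inr) ` ?E"
    then obtain e where "e \<in> edges G" "v \<in> e" "c (Inr e) = c (Inl v)"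
      by auto
    then show False
      using c(1) unfolding total_coloring_def by blast
  qed
  \<comment> \<open>A vertex and its incident edges conflict pairwise, hence one color more than the
    degree.\<close>
  ultimately have "card (insert (c (Inl v)) ((c \<circ> Inr) ` ?E)) = Suc (card ?E)"
    using fin by (simp add: card_image del: image_comp comp_apply image_cong_simp)
  moreover have "insert (c (Inl v)) ((c \<circ> Inr) ` ?E) \<subseteq> {..<k}"
    using c(2) assms(3) by auto
  then have "card (insert (c (Inl v)) ((c \<circ> Inr) ` ?E)) \<le> card {..<k}"
    by (intro card_mono finite_lessThan)
  ultimately show ?thesis
    unfolding degree_def by (simp only: Suc_le_eq card_lessThan)
qed

lemma total_chromatic_numberI:
  fixes c :: "'v + 'v set \<Rightarrow> nat"
  assumes "finite (verts G)" "simple_graph G" "verts G \<noteq> {}"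
    and "total_coloring G c" "c ` (verts G <+> edges G) \<subseteq> {..<max_degree G + 2}"
  shows "total_chromatic_number G \<in> {max_degree G + 1, max_degree G + 2}"
proof -
  let ?P = "\<lambda>k. \<exists>c :: 'v + 'v set \<Rightarrow> nat. total_coloring G c \<and> c ` (verts G <+> edges G) \<subseteq> {..<k}"
  have P: "?P (max_degree G + 2)"
    using assms(4,5) by blast
  then have upper: "total_chromatic_number G \<le> max_degree G + 2"
    unfolding total_chromatic_number_def by (rule Least_le)
  \<comment> \<open>The minimum is attained, so the lower bound applies to an optimal
    coloring.\<close>
  have "?P (total_chromatic_number G)"
    using P unfolding total_chromatic_number_def by (rule LeastI)
  moreover obtain v where "v \<in> verts G" "max_degree G = degree G v"
    using Max_in[OF finite_imageI[OF assms(1)], of "degree G"] assms(3)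
    unfolding max_degree_def by blast
  ultimately have "max_degree G < total_chromatic_number G"
    using total_coloring_degree_less[OF assms(1,2)] by metis
  with upper show ?thesis by auto
qed

section \<open>Ranks and modular matchings\<close>

definition rank_in :: "('a \<Rightarrow> nat) \<Rightarrow> 'a set \<Rightarrow> 'a \<Rightarrow> nat" where
  "rank_in f C x = card {y \<in> C. f y < f x}"

lemma rank_in_less_card:
  assumes "finite C" "x \<in> C"
  shows "rank_in f C x < card C"
  unfolding rank_in_def using assms by (intro psubset_card_mono) auto

lemma inj_on_rank_in:
  assumes "finite C" "inj_on f C"
  shows "inj_on (rank_in f C) C"
proof (rule inj_onI)
  fix x y assume xy: "x \<in> C" "y \<in> C" "rank_in f C x = rank_in f C y"
  \<comment> \<open>Strictness: \<open>u\<close> is counted in the rank of \<open>v\<close> but not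
    in its own.\<close>
  have "rank_in f C u < rank_in f C v" if "u \<in> C" "v \<in> C" "f u < f v" for u v
    unfolding rank_in_def using that assms(1) by (intro psubset_card_mono) auto
  with xy have "f x = f y"
    by (metis less_irrefl linorder_neqE_nat)
  with xy assms(2) show "x = y"
    by (auto dest: inj_onD)
qed

text \<open>Complementing the second end of the edge from \<open>A\<close> to
  \<open>S - A - {x}\<close> turns it into the step from \<open>A\<close> up to
  \<open>insert x A\<close> in the cube: \<open>A\<close> is the lower end,
  \<open>insert x A\<close> the upper.\<close>

definition mod_color :: "nat \<Rightarrow> 'a set \<Rightarrow> ('a \<Rightarrow> nat) \<Rightarrow> 'a set \<Rightarrow> 'a \<Rightarrow> nat" where
  "mod_color n S f A x = (sum f A + rank_in f (S - A) x) mod n"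

text \<open>\<open>b\<close> breaks the symmetry of a matched pair: its two ends partition
  \<open>S - {a}\<close>, so exactly one contains \<open>b\<close>.\<close>

locale odd_graph_coloring =
  fixes n :: nat and S :: "'a set" and f :: "'a \<Rightarrow> nat" and a b :: 'a
  assumes n: "n \<ge> 2"
    and f: "bij_betw f S {..<2 * n - 1}"
    and a: "a \<in> S" and b: "b \<in> S" "b \<noteq> a"
begin

lemma finite_S: "finite S" and card_S: "card S = 2 * n - 1"
  using f by (auto simp: bij_betw_finite bij_betw_same_card)

lemma inj_f: "inj_on f S"
  using f by (rule bij_betw_imp_inj_on)

text \<open>As the values of \<open>f\<close> fill an initial segment, every number below
  \<open>f x\<close> is taken.\<close>

lemma rank_in_S:
  assumes "x \<in> S"
  shows "rank_in f S x = f x"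
proof -
  have "f ` {y \<in> S. f y < f x} = {..<f x}"
  proof -
    have *: "f ` S = {..<2 * n - 1}"
      using f by (rule bij_betw_imp_surj_on)
    then have "f x < 2 * n - 1"
      using assms by auto
    then have "{..<f x} \<subseteq> f ` S"
      using * by auto
    then show ?thesis by fastforce
  qed
  moreover have "inj_on f {y \<in> S. f y < f x}"
    using inj_f by (rule inj_on_subset) auto
  ultimately show ?thesis
    unfolding rank_in_def by (metis card_image card_lessThan)
qed

abbreviation color :: "'a set \<Rightarrow> 'a \<Rightarrow> nat" where
  "color \<equiv> mod_color n S f"

lemma color_less: "color A x < n"
  unfolding mod_color_def using n by simp

text \<open>The sum over \<open>A\<close> cancels, and ranks in the \<open>n\<close>-element set
  \<open>S - A\<close> are distinct and below \<open>n\<close>.\<close>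

lemma color_inj_lower:
  assumes "A \<subseteq> S" "card A = n - 1" "x \<in> S - A" "y \<in> S - A" "color A x = color A y"
  shows "x = y"
proof -
  have card: "card (S - A) = n"
    using assms(1,2) finite_S card_S n by (simp add: card_Diff_subset finite_subset)
  have fin: "finite (S - A)"
    using finite_S by simp
  have "[rank_in f (S - A) x = rank_in f (S - A) y] (mod n)"
    using assms(5) unfolding mod_color_def cong_def[symmetric] by (simp add: cong_add_lcancel_nat)
  then have "rank_in f (S - A) x = rank_in f (S - A) y"
    using rank_in_less_card[OF fin] assms(3,4) card by (metis cong_less_modulus_unique_nat)
  moreover have "inj_on f (S - A)"
    using inj_f by (rule inj_on_subset) auto
  ultimately show ?thesis
    using inj_on_rank_in[OF fin] assms(3,4) by (auto dest: inj_onD)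
qed

text \<open>From the upper end \<open>C\<close> of an edge, the color is the sum over \<open>C\<close> minus the rank of \<open>x\<close> in \<open>C\<close>.\<close>

lemma color_upper_aux:
  assumes "C \<subseteq> S" "x \<in> C"
  shows "sum f (C - {x}) + rank_in f (S - (C - {x})) x + rank_in f C x = sum f C"
proof -
  have finC: "finite C"
    using assms(1) finite_S by (rule finite_subset)
  \<comment> \<open>\<open>S - (C - {x})\<close> and \<open>C\<close> share only \<open>x\<close>,
    which the strict inequality leaves out.\<close>
  have "{y \<in> S. f y < f x} = {y \<in> S - (C - {x}). f y < f x} \<union> {y \<in> C. f y < f x}"
    using assms by auto
  moreover have "{y \<in> S - (C - {x}). f y < f x} \<inter> {y \<in> C. f y < f x} = {}"
    by auto
  ultimately have "rank_in f S x = rank_in f (S - (C - {x})) x + rank_in f C x"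
    unfolding rank_in_def using finite_S finC by (simp add: card_Un_disjoint)
  then have "f x = rank_in f (S - (C - {x})) x + rank_in f C x"
    using rank_in_S assms by auto
  then show ?thesis
    using sum.remove[OF finC assms(2), of f] by simp
qed

lemma color_inj_upper:
  assumes "C \<subseteq> S" "card C = n" "x \<in> C" "y \<in> C" "color (C - {x}) x = color (C - {y}) y"
  shows "x = y"
proof -
  have fin: "finite C"
    using assms(1) finite_S by (rule finite_subset)
  let ?u = "\<lambda>x. sum f (C - {x}) + rank_in f (S - (C - {x})) x"
  have "[?u x = ?u y] (mod n)"
    using assms(5) unfolding mod_color_def cong_def .
  \<comment> \<open>Since \<open>?u x\<close> plus the rank of \<open>x\<close> in \<open>C\<close>
    is the same for all \<open>x\<close> in \<open>C\<close>, adding the rank of \<open>y\<close>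
    reduces the claim to ranks without any subtraction.\<close>
  then have "[?u y + rank_in f C y = ?u x + rank_in f C y] (mod n)"
    by (rule cong_add[OF cong_sym cong_refl])
  moreover have "?u x + rank_in f C x = ?u y + rank_in f C y"
    using color_upper_aux[OF assms(1)] assms(3,4) by simp
  ultimately have "[?u x + rank_in f C x = ?u x + rank_in f C y] (mod n)"
    by (simp only:)
  then have "[rank_in f C x = rank_in f C y] (mod n)"
    by (simp only: cong_add_lcancel_nat)
  then have "rank_in f C x = rank_in f C y"
    using rank_in_less_card[OF fin] assms(2-4) by (metis cong_less_modulus_unique_nat)
  moreover have "inj_on f C"
    using inj_f assms(1) by (rule inj_on_subset)
  ultimately show ?thesis
    using inj_on_rank_in[OF fin] assms(3,4) by (auto dest: inj_onD)
qed

section \<open>Edges of the odd graph\<close>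

abbreviation G :: "'a set graph" where
  "G \<equiv> odd_graph n S"

lemma verts_iff: "A \<in> verts G \<longleftrightarrow> A \<subseteq> S \<and> card A = n - 1"
  by (simp add: odd_graph_def Let_def)

lemma vert_facts:
  assumes "A \<in> verts G"
  shows "A \<subseteq> S" "finite A" "card A = n - 1" "card (S - A) = n"
  using assms finite_S card_S n
  by (auto simp: verts_iff card_Diff_subset finite_subset)

text \<open>Two disjoint vertices cover \<open>2 * n - 2\<close> of the \<open>2 * n - 1\<close>
  points, so the point left over determines the neighbour.\<close>

lemma edge_iff:
  assumes "A \<in> verts G"
  shows "{A, B} \<in> edges G \<longleftrightarrow> (\<exists>x \<in> S - A. B = S - A - {x})"
proof
  assume "{A, B} \<in> edges G"
  then have B: "B \<in> verts G" and AB: "A \<inter> B = {}"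
    by (auto simp: odd_graph_def Let_def doubleton_eq_iff)
  have "card (S - A - B) = 1"
    using vert_facts[OF assms] vert_facts[OF B] AB n
    by (subst card_Diff_subset) auto
  then obtain x where "S - A - B = {x}"
    by (auto simp: card_1_singleton_iff)
  moreover have "B \<subseteq> S - A"
    using vert_facts[OF B] AB by auto
  ultimately have "x \<in> S - A" "B = S - A - {x}"
    by blast+
  then show "\<exists>x \<in> S - A. B = S - A - {x}" by blast
next
  assume "\<exists>x \<in> S - A. B = S - A - {x}"
  then obtain x where x: "x \<in> S - A" and B: "B = S - A - {x}" by blast
  have "card B = n - 1"
    using vert_facts[OF assms] x unfolding B by simp
  then have "B \<in> verts G"
    using B by (auto simp: verts_iff)
  moreover have AB: "A \<inter> B = {}"
    using B by auto
  \<comment> \<open>Disjoint sets differ unless both are empty, which \<open>n \<ge> 2\<close>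
    excludes.\<close>
  moreover have "A \<noteq> {}"
    using vert_facts[OF assms] n by auto
  then have "A \<noteq> B"
    using AB by auto
  ultimately have "\<exists>A' B'. {A, B} = {A', B'} \<and> A' \<in> verts G \<and> B' \<in> verts G
      \<and> A' \<noteq> B' \<and> A' \<inter> B' = {}"
    using assms by (intro exI[of _ A] exI[of _ B] conjI refl)
  then show "{A, B} \<in> edges G"
    unfolding odd_graph_def Let_def fst_conv snd_conv mem_Collect_eq[of "{A, B}"] .
qed

lemma edgeE:
  assumes "e \<in> edges G"
  obtains (upper) A x where "A \<in> verts G" "a \<in> A" "x \<in> S - A" "x \<noteq> a" "e = {A, S - A - {x}}"
  | (matching) A where "A \<in> verts G" "a \<notin> A" "e = {A, S - A - {a}}"
proof -
  from assms obtain A B where A: "A \<in> verts G" and B: "B \<in> verts G" and e: "e = {A, B}"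
    and AB: "A \<inter> B = {}"
    by (auto simp: odd_graph_def Let_def)
  obtain x where x: "x \<in> S - A" "B = S - A - {x}"
    using edge_iff[OF A] assms e by blast
  obtain y where y: "y \<in> S - B" "A = S - B - {y}"
    using edge_iff[OF B] assms e by (metis insert_commute)
  consider "a \<in> A" | "a \<in> B" | "a \<notin> A" "a \<notin> B" by blast
  then show thesis
  proof cases
    case 1
    then show thesis using upper[of A x] A x e by auto
  next
    case 2
    then show thesis using upper[of B y] B y e by (auto simp: insert_commute)
  next
    case 3
    then have "x = a" using x a by auto
    then show thesis using matching[of A] A 3 x e by auto
  qed
qed

section \<open>The total coloring\<close>

definition edge_color :: "'a set set \<Rightarrow> nat" where
  "edge_color e = (if a \<in> \<Union>e then color (THE A. A \<in> e \<and> a \<in> A) (the_elem (S - \<Union>e)) else n)"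

text \<open>The third case takes the color of removing \<open>a\<close> from the upper end
  \<open>S - A\<close>; the edges at \<open>A\<close> outside the matching remove other points, so
  they miss it.\<close>

definition vertex_color :: "'a set \<Rightarrow> nat" where
  "vertex_color A = (if a \<in> A then n else if b \<in> A then n + 1 else color (S - A - {a}) a)"

text \<open>The ends are disjoint, so only \<open>A\<close> contains \<open>a\<close>, and
  \<open>x\<close> is the only point outside both; thus the unordered edge determines
  \<open>A\<close> and \<open>x\<close>.\<close>

lemma edge_color_upper:
  assumes "A \<in> verts G" "a \<in> A" "x \<in> S - A"
  shows "edge_color {A, S - A - {x}} = color A x"
proof -
  have "(THE A'. A' \<in> {A, S - A - {x}} \<and> a \<in> A') = A"
    using assms by (intro the_equality) auto
  moreover have "S - \<Union>{A, S - A - {x}} = {x}"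
    using assms by auto
  ultimately show ?thesis
    unfolding edge_color_def using assms(2) by simp
qed

lemma edge_color_matching:
  assumes "a \<notin> A"
  shows "edge_color {A, S - A - {a}} = n"
  using assms by (simp add: edge_color_def)

text \<open>Seen from its end without \<open>a\<close>, the edge removes \<open>x\<close> from
  \<open>S - B\<close>, the form needed for \<open>color_inj_upper\<close>.\<close>

lemma upper_edge_at:
  assumes "A \<in> verts G" "a \<in> A" "x \<in> S - A" "B \<in> {A, S - A - {x}}"
  shows "B = A \<or> a \<notin> B \<and> x \<in> S - B \<and> A = S - B - {x}"
  using assms vert_facts(1)[OF assms(1)] by auto

lemma edge_color_proper:
  assumes e: "e \<in> edges G" and g: "g \<in> edges G" and "B \<in> e" "B \<in> g"
    and eq: "edge_color e = edge_color g"
  shows "e = g"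
  using e
proof (cases rule: edgeE)
  case e: (upper A x)
  from g show ?thesis
  proof (cases rule: edgeE)
    case g: (upper A' y)
    have eq': "color A x = color A' y"
      using eq edge_color_upper e g by simp
    have B: "B = A \<or> a \<notin> B \<and> x \<in> S - B \<and> A = S - B - {x}"
      "B = A' \<or> a \<notin> B \<and> y \<in> S - B \<and> A' = S - B - {y}"
      using upper_edge_at e g assms(3,4) by metis+
    show ?thesis
    \<comment> \<open>Membership of \<open>a\<close> decides whether the edges share their lower or
      their upper end.\<close>
    proof (cases "a \<in> B")
      case True
      then have "A = A'" using B by auto
      then have "x = y"
        using color_inj_lower[of A x y] vert_facts[OF e(1)] e g eq' by auto
      with \<open>A = A'\<close> e g show ?thesis by simp
    next
      case False
      then have *: "x \<in> S - B" "A = S - B - {x}" "y \<in> S - B" "A' = S - B - {y}"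
        using B e g by auto
      have "B \<in> verts G"
        using assms(3) \<open>e \<in> edges G\<close> simple_graph_odd_graph[of n S]
        by (auto simp: simple_graph_def)
      then have "x = y"
        using color_inj_upper[of "S - B" x y] vert_facts * eq' by auto
      with * e g show ?thesis by simp
    qed
  next
    case g: (matching A')
    then show ?thesis
      using eq e edge_color_upper edge_color_matching color_less by (metis less_irrefl)
  qed
next
  case e: (matching A)
  from g show ?thesis
  proof (cases rule: edgeE)
    case g: (upper A' y)
    then show ?thesis
      using eq e edge_color_upper edge_color_matching color_less by (metis less_irrefl)
  next
    case g: (matching A')
    have "e = {B, S - B - {a}}" "g = {B, S - B - {a}}"
      using e g assms(3,4) vert_facts(1)[OF e(1)] vert_facts(1)[OF g(1)] a by auto
    then show ?thesis by simp
  qed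
qed

lemma vertex_color_proper:
  assumes "{A, B} \<in> edges G"
  shows "vertex_color A \<noteq> vertex_color B"
  using assms
proof (cases rule: edgeE)
  case (upper A' x)
  have "vertex_color A' = n" "vertex_color (S - A' - {x}) \<noteq> n"
    using upper color_less[of "S - (S - A' - {x}) - {a}" a] by (auto simp: vertex_color_def)
  with upper show ?thesis by (auto simp: doubleton_eq_iff)
next
  case (matching A')
  let ?B = "S - A' - {a}"
  \<comment> \<open>Hence one end gets \<open>n + 1\<close> and the other a color below
    \<open>n\<close>.\<close>
  have "b \<in> A' \<longleftrightarrow> b \<notin> ?B"
    using b by auto
  then have "vertex_color A' \<noteq> vertex_color ?B"
    using matching color_less[of "S - A' - {a}" a] color_less[of "S - ?B - {a}" a]
    by (auto simp: vertex_color_def)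
  with matching show ?thesis by (auto simp: doubleton_eq_iff)
qed

lemma vertex_edge_color_proper:
  assumes "e \<in> edges G" "B \<in> e"
  shows "edge_color e \<noteq> vertex_color B"
  using assms(1)
proof (cases rule: edgeE)
  case (upper A x)
  then have ec: "edge_color e = color A x"
    using edge_color_upper by simp
  consider "B = A" | "a \<notin> B" "x \<in> S - B" "A = S - B - {x}"
    using upper_edge_at upper assms(2) by metis
  then show ?thesis
  proof cases
    case 1
    then show ?thesis
      using ec upper color_less[of A x] by (simp add: vertex_color_def)
  next
    case 2
    have "B \<in> verts G"
      using assms simple_graph_odd_graph[of n S] by (auto simp: simple_graph_def)
    \<comment> \<open>Removing the distinct points \<open>x\<close> and \<open>a\<close> from
      \<open>S - B\<close> gives distinct colors.\<close>
    then have "color A x \<noteq> color (S - B - {a}) a"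
      using color_inj_upper[of "S - B" x a] vert_facts[of B] 2 upper a by auto
    then show ?thesis
      using ec 2 color_less[of A x] by (auto simp: vertex_color_def)
  qed
next
  case (matching A)
  then have "edge_color e = n" "a \<notin> B"
    using edge_color_matching assms(2) by auto
  then show ?thesis
    using color_less[of "S - B - {a}" a] by (auto simp: vertex_color_def)
qed

lemma total_coloring_odd_graph: "total_coloring G (case_sum vertex_color edge_color)"
  unfolding total_coloring_def sum.case
  using vertex_color_proper edge_color_proper vertex_edge_color_proper by blast

lemma case_sum_color_less: "case_sum vertex_color edge_color z < n + 2"
  using color_less[THEN less_trans, of "n + 2"]
  by (cases z) (simp_all add: vertex_color_def edge_color_def)

section \<open>Degrees and conclusion\<close>

lemma finite_verts: "finite (verts G)"
  using finite_S by (simp add: odd_graph_def Let_def)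

lemma verts_nonempty: "verts G \<noteq> {}"
proof -
  have "n - 1 \<le> card S"
    using card_S by simp
  then obtain A where "A \<subseteq> S" "card A = n - 1"
    by (rule obtain_subset_with_card_n)
  then show ?thesis using verts_iff by blast
qed

text \<open>A lower bound is enough: it makes the \<open>n + 2\<close> colors fit into
  \<open>max_degree G + 2\<close>.\<close>

lemma degree_ge:
  assumes "A \<in> verts G"
  shows "n \<le> degree G A"
proof -
  let ?h = "\<lambda>x. {A, S - A - {x}}"
  have "inj_on ?h (S - A)"
    by (rule inj_onI) (auto simp: doubleton_eq_iff)
  then have card: "card (?h ` (S - A)) = n"
    using vert_facts[OF assms] by (simp add: card_image)
  have sub: "?h ` (S - A) \<subseteq> {e \<in> edges G. A \<in> e}"
    using edge_iff[OF assms] by auto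
  have "finite {e \<in> edges G. A \<in> e}"
  proof (rule finite_subset)
    show "{e \<in> edges G. A \<in> e} \<subseteq> Pow (verts G)"
      using simple_graph_odd_graph[of n S] by (auto simp: simple_graph_def)
  qed (simp add: finite_verts)
  then show ?thesis
    unfolding degree_def by (rule card_mono[OF _ sub, unfolded card])
qed

lemma max_degree_ge: "n \<le> max_degree G"
proof -
  obtain A where "A \<in> verts G"
    using verts_nonempty by blast
  then show ?thesis
    unfolding max_degree_def using degree_ge[of A] finite_verts
    by (intro order_trans[OF _ Max_ge]) auto
qed

lemma total_chromatic_number_odd_graph:
  "total_chromatic_number G \<in> {max_degree G + 1, max_degree G + 2}"
proof (rule total_chromatic_numberI)
  show "case_sum vertex_color edge_color ` (verts G <+> edges G) \<subseteq> {..<max_degree G + 2}"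
    using less_le_trans[OF case_sum_color_less add_le_mono1[OF max_degree_ge]] by auto
qed (use finite_verts simple_graph_odd_graph verts_nonempty total_coloring_odd_graph in auto)

end

theorem theorem3p3:
  fixes n :: nat and S :: "'a set"
  assumes "n \<ge> 1" and "finite S" and "card S = 2 * n - 1"
  shows "total_chromatic_number (odd_graph n S) \<in>
           {max_degree (odd_graph n S) + 1, max_degree (odd_graph n S) + 2}"
proof (cases "n = 1")
  case True
  then have V: "verts (odd_graph n S) = {{}}" and E: "edges (odd_graph n S) = {}"
    using assms(2) by (auto simp: odd_graph_def Let_def finite_subset)
  show ?thesis
    \<comment> \<open>The graph is a single vertex without edges, so one color serves.\<close>
    by (rule total_chromatic_numberI[where c = "\<lambda>_. 0"])
      (use V E in \<open>auto simp: simple_graph_odd_graph total_coloring_def\<close>)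
next
  case False
  then have "n \<ge> 2" using assms(1) by simp
  obtain f where f: "bij_betw f S {..<2 * n - 1}"
    using ex_bij_betw_finite_nat[OF assms(2)] assms(3) by (auto simp: lessThan_atLeast0)
  have "2 \<le> card S" using assms(3) \<open>n \<ge> 2\<close> by simp
  then obtain T where "T \<subseteq> S" "card T = 2"
    by (rule obtain_subset_with_card_n)
  then obtain a b where "a \<in> S" "b \<in> S" "b \<noteq> a"
    by (auto simp: card_2_iff)
  with f \<open>n \<ge> 2\<close> interpret odd_graph_coloring n S f a b
    by unfold_locales
  show ?thesis by (rule total_chromatic_number_odd_graph)
qed

end
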